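(* Let $R$ be the Renner monoid of a reductive algebraic monoid, with unit group $W$ and cross section lattice $\Lambda$. Let $e\in\Lambda$, let $W/W_*(e)$ be the set of left cosets of $W_*(e)$ in $W$, and let $W(e)$ act on $W/W_*(e)$ by $w\cdot uW_*(e)=wuw^{-1}W_*(e)$ for $w\in W(e)$, $u\in W$. Let $u,v\in W$. Then the elements $ue$ and $ve$ of $We=\{we\mid w\in W\}$ are conjugate in $R$ (that is, $ue\sim ve$) if and only if the two cosets $uW_*(e)$ and $vW_*(e)$ are in the same $W(e)$-orbit in $W/W_*(e)$.
   Context: Let $M$ be a reductive algebraic monoid over an algebraically closed field (an irreducible linear algebraic monoid whose unit group $G$ is a reductive group). Let $T\subseteq B\subseteq G$ be a maximal torus and a Borel subgroup, $N$ the normalizer of $T$ in $G$, and let $\overline N,\overline T$ be the Zariski closures of $N,T$ in $M$. The Renner monoid of $M$ is $R=\overline N/T$; it is a finite inverse monoid whose unit group is the Weyl group $W=N/T$. The idempotents of $R$ are identified with $E(\overline T)=\{e\in\overline T\mid e^2=e\}$. The cross section lattice is $\Lambda=\{e\in E(\overline T)\mid Be=eBe\}$. For $e\in\Lambda$ put $W(e)=\{w\in W\mid we=ew\}$ (centralizer) and $W_*(e)=\{w\in W\mid we=ew=e\}$ (stabilizer); $W_*(e)$ is a normal subgroup of $W(e)$, so the displayed action is well defined. Elements $\sigma,\tau\in R$ are conjugate, written $\sigma\sim\tau$, if $\tau=w\sigma w^{-1}$ for some $w\in W$. *)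

theory Defs
  imports
    "Jordan_Normal_Form.Determinant"
    "HOL-Algebra.Group_Action"
    "HOL-Algebra.Left_Coset"
    "HOL-Algebra.Solvable_Groups"
    "HOL-Analysis.Abstract_Topology"
begin

text \<open>Linear algebraic monoids are taken as Zariski closed submonoids of the monoid of all
  \<open>n \<times> n\<close> matrices over an algebraically closed field. Up to isomorphism these are all the
  affine algebraic monoids.\<close>

section \<open>Zariski topology and regular functions\<close>

inductive_set poly_fun :: "nat \<Rightarrow> ('k::field mat \<Rightarrow> 'k) set" for n where
  const: "(\<lambda>A. c) \<in> poly_fun n"
| entry: "\<lbrakk>i < n; j < n\<rbrakk> \<Longrightarrow> (\<lambda>A. A $$ (i, j)) \<in> poly_fun n"
| add: "\<lbrakk>f \<in> poly_fun n; g \<in> poly_fun n\<rbrakk> \<Longrightarrow> (\<lambda>A. f A + g A) \<in> poly_fun n"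
| mult: "\<lbrakk>f \<in> poly_fun n; g \<in> poly_fun n\<rbrakk> \<Longrightarrow> (\<lambda>A. f A * g A) \<in> poly_fun n"

definition zero_locus :: "nat \<Rightarrow> ('k::field mat \<Rightarrow> 'k) set \<Rightarrow> 'k mat set" where
  "zero_locus n F = {A \<in> carrier_mat n n. \<forall>f\<in>F. f A = 0}"

definition zariski :: "nat \<Rightarrow> 'k::field mat topology" where
  "zariski n = topology (\<lambda>U. U \<subseteq> carrier_mat n n \<and>
     (\<exists>F \<subseteq> poly_fun n. carrier_mat n n - U = zero_locus n F))"

lemma istopology_zariski:
  "istopology (\<lambda>U :: 'k::field mat set. U \<subseteq> carrier_mat n n \<and>
     (\<exists>F \<subseteq> poly_fun n. carrier_mat n n - U = zero_locus n F))"
  unfolding istopology_def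
proof (intro conjI allI impI; (elim conjE exE)?)
  fix S T :: "'k mat set" and F G
  assume S: "S \<subseteq> carrier_mat n n" and F: "F \<subseteq> poly_fun n" "carrier_mat n n - S = zero_locus n F"
    and G: "G \<subseteq> poly_fun n" "carrier_mat n n - T = zero_locus n G"
  show "S \<inter> T \<subseteq> carrier_mat n n" using S by blast
  let ?H = "{\<lambda>A. f A * g A | f g. f \<in> F \<and> g \<in> G}"
  have "?H \<subseteq> poly_fun n" using F(1) G(1) by (auto intro: poly_fun.mult)
  moreover have "zero_locus n ?H = zero_locus n F \<union> zero_locus n G"
  proof (intro equalityI subsetI)
    fix A assume A: "A \<in> zero_locus n ?H"
    show "A \<in> zero_locus n F \<union> zero_locus n G"
    proof (rule ccontr)
      assume "A \<notin> zero_locus n F \<union> zero_locus n G"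
      with A obtain f g where "f \<in> F" "g \<in> G" "f A \<noteq> 0" "g A \<noteq> 0"
        by (auto simp: zero_locus_def)
      moreover have "f A * g A = 0"
        using A \<open>f \<in> F\<close> \<open>g \<in> G\<close> unfolding zero_locus_def by fastforce
      ultimately show False by simp
    qed
  next
    fix A assume "A \<in> zero_locus n F \<union> zero_locus n G"
    then show "A \<in> zero_locus n ?H" by (auto simp: zero_locus_def)
  qed
  ultimately show "\<exists>H \<subseteq> poly_fun n. carrier_mat n n - S \<inter> T = zero_locus n H"
    using F(2) G(2) by (intro exI[of _ ?H]) blast
next
  fix \<K> :: "'k mat set set"
  assume K: "\<forall>K\<in>\<K>. K \<subseteq> carrier_mat n n \<and>
     (\<exists>F \<subseteq> poly_fun n. carrier_mat n n - K = zero_locus n F)"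
  show "\<Union>\<K> \<subseteq> carrier_mat n n" using K by blast
  from K obtain F where F: "\<And>K. K \<in> \<K> \<Longrightarrow> F K \<subseteq> poly_fun n \<and> carrier_mat n n - K = zero_locus n (F K)"
    by metis
  have "carrier_mat n n - \<Union>\<K> = zero_locus n (\<Union>K\<in>\<K>. F K)"
    using F unfolding zero_locus_def by (intro equalityI subsetI) (blast+)
  then show "\<exists>H \<subseteq> poly_fun n. carrier_mat n n - \<Union>\<K> = zero_locus n H"
    using F by (intro exI[of _ "\<Union>K\<in>\<K>. F K"]) blast
qed

definition irreducible_in :: "'a topology \<Rightarrow> 'a set \<Rightarrow> bool" where
  "irreducible_in X S \<longleftrightarrow> S \<subseteq> topspace X \<and> S \<noteq> {} \<and>
     (\<forall>C D. closedin X C \<and> closedin X D \<and> S \<subseteq> C \<union> D \<longrightarrow> S \<subseteq> C \<or> S \<subseteq> D)"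

text \<open>Intended for closed subsets \<open>S\<close> of \<open>GL\<^sub>n\<close>, whose coordinate ring is generated by the
  matrix entries and the inverse of the determinant.\<close>

definition regular_on :: "nat \<Rightarrow> 'k::field mat set \<Rightarrow> ('k mat \<Rightarrow> 'k) \<Rightarrow> bool" where
  "regular_on n S f \<longleftrightarrow> (\<exists>p\<in>poly_fun n. \<exists>k. \<forall>A\<in>S. f A = p A / det A ^ k)"

definition regular_map :: "nat \<Rightarrow> 'k::field mat set \<Rightarrow> nat \<Rightarrow> ('k mat \<Rightarrow> 'k mat) \<Rightarrow> bool" where
  "regular_map n S m \<phi> \<longleftrightarrow> (\<forall>i<m. \<forall>j<m. regular_on n S (\<lambda>A. \<phi> A $$ (i, j)))"

section \<open>Linear algebraic monoids and groups\<close>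

definition mat_monoid :: "nat \<Rightarrow> 'k::field mat set \<Rightarrow> 'k mat monoid" where
  "mat_monoid n M = \<lparr>carrier = M, mult = (*), one = 1\<^sub>m n\<rparr>"

definition linear_algebraic_monoid :: "nat \<Rightarrow> 'k::field mat set \<Rightarrow> bool" where
  "linear_algebraic_monoid n M \<longleftrightarrow>
     submonoid M (mat_monoid n (carrier_mat n n)) \<and> closedin (zariski n) M"

definition unit_group :: "nat \<Rightarrow> 'k::field mat set \<Rightarrow> 'k mat monoid" where
  "unit_group n M = units_of (mat_monoid n M)"

definition closed_subgroup :: "nat \<Rightarrow> 'k::field mat monoid \<Rightarrow> 'k mat set \<Rightarrow> bool" where
  "closed_subgroup n G H \<longleftrightarrow>
     subgroup H G \<and> closedin (subtopology (zariski n) (carrier G)) H"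

definition unipotent_mat :: "nat \<Rightarrow> 'k::field mat \<Rightarrow> bool" where
  "unipotent_mat n A \<longleftrightarrow> A \<in> carrier_mat n n \<and> (\<exists>k. (A - 1\<^sub>m n) ^\<^sub>m k = 0\<^sub>m n n)"

text \<open>The unipotent radical is the largest closed connected normal unipotent subgroup. It is the
  union of all of them, since the product of two such subgroups is again one.\<close>

definition unipotent_radical :: "nat \<Rightarrow> 'k::field mat monoid \<Rightarrow> 'k mat set" where
  "unipotent_radical n G = \<Union>{U. closed_subgroup n G U \<and> connectedin (zariski n) U \<and>
     U \<lhd> G \<and> (\<forall>A\<in>U. unipotent_mat n A)}"

definition reductive_group :: "nat \<Rightarrow> 'k::field mat monoid \<Rightarrow> bool" where
  "reductive_group n G \<longleftrightarrow>
     group G \<and> connectedin (zariski n) (carrier G) \<and> unipotent_radical n G = {\<one>\<^bsub>G\<^esub>}"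

definition reductive_monoid :: "nat \<Rightarrow> 'k::field mat set \<Rightarrow> bool" where
  "reductive_monoid n M \<longleftrightarrow> linear_algebraic_monoid n M \<and> irreducible_in (zariski n) M \<and>
     reductive_group n (unit_group n M)"

definition diag_group :: "nat \<Rightarrow> 'k::field mat monoid" where
  "diag_group r = mat_monoid r {A \<in> carrier_mat r r. diagonal_mat A \<and> (\<forall>i<r. A $$ (i, i) \<noteq> 0)}"

definition torus :: "nat \<Rightarrow> 'k::field mat monoid \<Rightarrow> 'k mat set \<Rightarrow> bool" where
  "torus n G T \<longleftrightarrow> closed_subgroup n G T \<and>
     (\<exists>r \<phi>. \<phi> \<in> iso (diag_group r) (G\<lparr>carrier := T\<rparr>) \<and>
        regular_map r (carrier (diag_group r)) n \<phi> \<and>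
        regular_map n T r (inv_into (carrier (diag_group r)) \<phi>))"

definition maximal_torus :: "nat \<Rightarrow> 'k::field mat monoid \<Rightarrow> 'k mat set \<Rightarrow> bool" where
  "maximal_torus n G T \<longleftrightarrow> torus n G T \<and> (\<forall>S. torus n G S \<and> T \<subseteq> S \<longrightarrow> S = T)"

definition connected_solvable :: "nat \<Rightarrow> 'k::field mat monoid \<Rightarrow> 'k mat set \<Rightarrow> bool" where
  "connected_solvable n G H \<longleftrightarrow> closed_subgroup n G H \<and> connectedin (zariski n) H \<and>
     solvable (G\<lparr>carrier := H\<rparr>)"

definition borel_subgroup :: "nat \<Rightarrow> 'k::field mat monoid \<Rightarrow> 'k mat set \<Rightarrow> bool" where
  "borel_subgroup n G B \<longleftrightarrow>
     connected_solvable n G B \<and> (\<forall>H. connected_solvable n G H \<and> B \<subseteq> H \<longrightarrow> H = B)"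

section \<open>The Renner monoid\<close>

definition zclosure :: "nat \<Rightarrow> 'k::field mat set \<Rightarrow> 'k mat set \<Rightarrow> 'k mat set" where
  "zclosure n M S = subtopology (zariski n) M closure_of S"

definition torus_normalizer :: "nat \<Rightarrow> 'k::field mat set \<Rightarrow> 'k mat set \<Rightarrow> 'k mat set" where
  "torus_normalizer n M T = normalizer (unit_group n M) T"

text \<open>The elements of \<open>R\<close> are the cosets \<open>xT\<close> and the product is the product of subsets of \<open>M\<close>,
  so that \<open>(xT)(yT) = xyT\<close>.\<close>

definition renner_monoid :: "nat \<Rightarrow> 'k::field mat set \<Rightarrow> 'k mat set \<Rightarrow> 'k mat set monoid" where
  "renner_monoid n M T =
     \<lparr>carrier = (\<lambda>x. x <#\<^bsub>mat_monoid n M\<^esub> T) ` zclosure n M (torus_normalizer n M T),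
      mult = set_mult (mat_monoid n M), one = T\<rparr>"

definition weyl_group :: "nat \<Rightarrow> 'k::field mat set \<Rightarrow> 'k mat set \<Rightarrow> 'k mat set monoid" where
  "weyl_group n M T = (unit_group n M)\<lparr>carrier := torus_normalizer n M T\<rparr> Mod T"

definition torus_idempotents :: "nat \<Rightarrow> 'k::field mat set \<Rightarrow> 'k mat set \<Rightarrow> 'k mat set" where
  "torus_idempotents n M T = {e \<in> zclosure n M T. e * e = e}"

definition cross_section_lattice ::
  "nat \<Rightarrow> 'k::field mat set \<Rightarrow> 'k mat set \<Rightarrow> 'k mat set \<Rightarrow> 'k mat set" where
  "cross_section_lattice n M T B = {e \<in> torus_idempotents n M T.
     B #>\<^bsub>mat_monoid n M\<^esub> e = e <#\<^bsub>mat_monoid n M\<^esub> B #>\<^bsub>mat_monoid n M\<^esub> e}"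

text \<open>The identification of an idempotent \<open>e\<close> of the closure of \<open>T\<close> with the idempotent \<open>eT\<close>
  of \<open>R\<close>.\<close>

definition renner_idem :: "nat \<Rightarrow> 'k::field mat set \<Rightarrow> 'k mat set \<Rightarrow> 'k mat \<Rightarrow> 'k mat set" where
  "renner_idem n M T e = e <#\<^bsub>mat_monoid n M\<^esub> T"

definition W_centralizer :: "nat \<Rightarrow> 'k::field mat set \<Rightarrow> 'k mat set \<Rightarrow> 'k mat \<Rightarrow> 'k mat set set" where
  "W_centralizer n M T e = {w \<in> carrier (weyl_group n M T).
     w \<otimes>\<^bsub>renner_monoid n M T\<^esub> renner_idem n M T e
     = renner_idem n M T e \<otimes>\<^bsub>renner_monoid n M T\<^esub> w}"

definition W_stabilizer :: "nat \<Rightarrow> 'k::field mat set \<Rightarrow> 'k mat set \<Rightarrow> 'k mat \<Rightarrow> 'k mat set set" where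
  "W_stabilizer n M T e = {w \<in> carrier (weyl_group n M T).
     w \<otimes>\<^bsub>renner_monoid n M T\<^esub> renner_idem n M T e
     = renner_idem n M T e \<otimes>\<^bsub>renner_monoid n M T\<^esub> w \<and>
     renner_idem n M T e \<otimes>\<^bsub>renner_monoid n M T\<^esub> w = renner_idem n M T e}"

definition renner_conj ::
  "nat \<Rightarrow> 'k::field mat set \<Rightarrow> 'k mat set \<Rightarrow> 'k mat set \<Rightarrow> 'k mat set \<Rightarrow> bool" where
  "renner_conj n M T \<sigma> \<tau> \<longleftrightarrow> (\<exists>w \<in> carrier (weyl_group n M T).
     \<tau> = w \<otimes>\<^bsub>renner_monoid n M T\<^esub> \<sigma> \<otimes>\<^bsub>renner_monoid n M T\<^esub> (inv\<^bsub>weyl_group n M T\<^esub> w))"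

definition W_cosets :: "nat \<Rightarrow> 'k::field mat set \<Rightarrow> 'k mat set \<Rightarrow> 'k mat \<Rightarrow> 'k mat set set set" where
  "W_cosets n M T e = lcosets\<^bsub>weyl_group n M T\<^esub> (W_stabilizer n M T e)"

text \<open>The action \<open>w \<cdot> uW\<^sub>*(e) = wuw\<^sup>-\<^sup>1W\<^sub>*(e)\<close>. The coset on the right does not depend on the
  representative \<open>u\<close> of \<open>C = uW\<^sub>*(e)\<close>, so the union below is this single coset.\<close>

definition coset_action ::
  "nat \<Rightarrow> 'k::field mat set \<Rightarrow> 'k mat set \<Rightarrow> 'k mat \<Rightarrow> 'k mat set \<Rightarrow> 'k mat set set \<Rightarrow> 'k mat set set" where
  "coset_action n M T e w C =
     (\<Union>u\<in>C. (w \<otimes>\<^bsub>weyl_group n M T\<^esub> u \<otimes>\<^bsub>weyl_group n M T\<^esub> (inv\<^bsub>weyl_group n M T\<^esub> w))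
        <#\<^bsub>weyl_group n M T\<^esub> W_stabilizer n M T e)"

definition same_coset_orbit ::
  "nat \<Rightarrow> 'k::field mat set \<Rightarrow> 'k mat set \<Rightarrow> 'k mat \<Rightarrow> 'k mat set set \<Rightarrow> 'k mat set set \<Rightarrow> bool" where
  "same_coset_orbit n M T e C D \<longleftrightarrow>
     (\<exists>X \<in> orbits ((weyl_group n M T)\<lparr>carrier := W_centralizer n M T e\<rparr>)
              (W_cosets n M T e) (coset_action n M T e). C \<in> X \<and> D \<in> X)"

end

theory Submission
  imports Defs "HOL-Algebra.Zassenhaus"
begin

text \<open>
  The point is that an element \<open>w\<close> of \<open>W\<close> conjugating \<open>ue\<close> to \<open>ve\<close> must centralize \<open>e\<close>. Write
  \<open>f = wew\<^sup>-\<^sup>1\<close> and \<open>x = wuw\<^sup>-\<^sup>1\<close>. If \<open>ve = w(ue)w\<^sup>-\<^sup>1 = xf\<close>, then \<open>f = x\<^sup>-\<^sup>1ve\<close>, so the idempotents \<open>e\<close> and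
  \<open>f\<close> are left multiples of each other by units. Since \<open>e\<close> and \<open>f\<close> also commute, they are equal, hence
  \<open>w \<in> W(e)\<close> and \<open>ve = xe\<close>. The latter says that the cosets \<open>xW\<^sub>*(e)\<close> and \<open>vW\<^sub>*(e)\<close> agree, because
  \<open>se = e\<close> forces \<open>es = e\<close> and so \<open>W\<^sub>*(e) = {s. se = e}\<close>. Thus \<open>v\<close> lies in the same orbit as \<open>u\<close>; every
  step reverses. The two lemmas carrying this are \<open>centralizer_if_conj_eq_translate\<close> and
  \<open>stabilizer_eq\<close>, and both rest only on the fact that \<open>e\<close> commutes with its conjugates under \<open>W\<close>.

  That fact is the only place where geometry enters. Commuting with a fixed matrix is a closed
  condition, so the closure of the commutative group \<open>T\<close> is again commutative. For the same reason,
  conjugation by an element of the normalizer of \<open>T\<close> takes elements of the closure to matrices that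
  commute with the closure (\<open>zclosure_conj_commute\<close>), hence \<open>wew\<^sup>-\<^sup>1\<close> commutes with \<open>e\<close>.

  Since the elements of \<open>R\<close> and \<open>W\<close> are cosets of \<open>T\<close>, the argument is transported from matrices to
  cosets by \<open>idempotent_over_weyl_group\<close>.
\<close>

section \<open>Conjugacy of translates of an idempotent\<close>

text \<open>From \<open>e = yf\<close> follows \<open>ef = e\<close>, and from \<open>f = y'e\<close> follows \<open>fe = f\<close>.\<close>

lemma (in monoid) commuting_idempotents_eq:
  assumes "e \<in> carrier G" "f \<in> carrier G" "y \<in> carrier G" "y' \<in> carrier G"
    and "e \<otimes> e = e" "f \<otimes> f = f" "e \<otimes> f = f \<otimes> e"
    and "e = y \<otimes> f" "f = y' \<otimes> e"
  shows "e = f"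
proof -
  have "e \<otimes> f = y \<otimes> (f \<otimes> f)" using assms(2,3,8) by (metis m_assoc)
  then have "e \<otimes> f = e" using assms(6,8) by metis
  moreover have "f \<otimes> e = y' \<otimes> (e \<otimes> e)" using assms(1,4,9) by (metis m_assoc)
  then have "f \<otimes> e = f" using assms(5,9) by metis
  ultimately show ?thesis using assms(7) by metis
qed

text \<open>The algebraic situation of the theorem: a group \<open>W\<close> of units of a monoid \<open>R\<close> and an idempotent
  \<open>e\<close>. The last assumption replaces the commutation of all idempotents in an inverse monoid, such as
  the Renner monoid, by the instances that the argument uses.\<close>

locale idempotent_over_unit_group = R: monoid R + W: group W
  for R :: "('a, 'r) monoid_scheme" (structure) and W :: "('a, 'w) monoid_scheme" +
  fixes e
  assumes W_subset: "carrier W \<subseteq> carrier R"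
    and W_mult: "mult W = mult R"
    and W_one: "one W = one R"
    and e_closed [simp]: "e \<in> carrier R"
    and e_idem: "e \<otimes> e = e"
    and e_comm_conj: "w \<in> carrier W \<Longrightarrow>
      (w \<otimes> e \<otimes> inv\<^bsub>W\<^esub> w) \<otimes> e = e \<otimes> (w \<otimes> e \<otimes> inv\<^bsub>W\<^esub> w)"
begin

definition centralizer :: "'a set" where
  "centralizer = {w \<in> carrier W. w \<otimes> e = e \<otimes> w}"

definition stabilizer :: "'a set" where
  "stabilizer = {w \<in> carrier W. w \<otimes> e = e \<otimes> w \<and> e \<otimes> w = e}"

definition conjugate :: "'a \<Rightarrow> 'a \<Rightarrow> bool" where
  "conjugate \<sigma> \<tau> \<longleftrightarrow> (\<exists>w\<in>carrier W. \<tau> = w \<otimes> \<sigma> \<otimes> inv\<^bsub>W\<^esub> w)"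

definition conj_coset :: "'a \<Rightarrow> 'a set \<Rightarrow> 'a set" where
  "conj_coset w C = (\<Union>u\<in>C. (w \<otimes>\<^bsub>W\<^esub> u \<otimes>\<^bsub>W\<^esub> inv\<^bsub>W\<^esub> w) <#\<^bsub>W\<^esub> stabilizer)"

lemma W_in_R [simp]: "w \<in> carrier W \<Longrightarrow> w \<in> carrier R"
  using W_subset by blast

lemma W_closed [simp]: "x \<in> carrier W \<Longrightarrow> y \<in> carrier W \<Longrightarrow> x \<otimes> y \<in> carrier W"
  using W.m_closed[of x y] by (simp add: W_mult)

lemma W_one_closed [simp]: "\<one> \<in> carrier W"
  using W.one_closed by (simp add: W_one)

lemma W_inv_cancel [simp]:
  assumes "w \<in> carrier W"
  shows "w \<otimes> inv\<^bsub>W\<^esub> w = \<one>" "inv\<^bsub>W\<^esub> w \<otimes> w = \<one>"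
    and "x \<in> carrier R \<Longrightarrow> w \<otimes> (inv\<^bsub>W\<^esub> w \<otimes> x) = x"
    and "x \<in> carrier R \<Longrightarrow> inv\<^bsub>W\<^esub> w \<otimes> (w \<otimes> x) = x"
proof -
  show r: "w \<otimes> inv\<^bsub>W\<^esub> w = \<one>" and l: "inv\<^bsub>W\<^esub> w \<otimes> w = \<one>"
    using W.r_inv[OF assms] W.l_inv[OF assms] by (simp_all add: W_mult W_one)
  show "w \<otimes> (inv\<^bsub>W\<^esub> w \<otimes> x) = x" if "x \<in> carrier R"
    using r that assms by (simp flip: R.m_assoc)
  show "inv\<^bsub>W\<^esub> w \<otimes> (w \<otimes> x) = x" if "x \<in> carrier R"
    using l that assms by (simp flip: R.m_assoc)
qed

lemma centralizer_commutes_inv: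
  assumes "w \<in> centralizer"
  shows "inv\<^bsub>W\<^esub> w \<otimes> e = e \<otimes> inv\<^bsub>W\<^esub> w"
proof -
  have w: "w \<in> carrier W" "w \<otimes> e = e \<otimes> w" using assms by (auto simp: centralizer_def)
  have "inv\<^bsub>W\<^esub> w \<otimes> e = inv\<^bsub>W\<^esub> w \<otimes> (e \<otimes> w) \<otimes> inv\<^bsub>W\<^esub> w" using w(1) by (simp add: R.m_assoc)
  also have "\<dots> = e \<otimes> inv\<^bsub>W\<^esub> w" using w(1) by (simp flip: w(2))
  finally show ?thesis .
qed

lemma conj_mult:
  assumes "w \<in> carrier W" "x \<in> carrier R"
  shows "w \<otimes> (x \<otimes> e) \<otimes> inv\<^bsub>W\<^esub> w = (w \<otimes> x \<otimes> inv\<^bsub>W\<^esub> w) \<otimes> (w \<otimes> e \<otimes> inv\<^bsub>W\<^esub> w)"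
  using assms by (simp add: R.m_assoc)

lemma conj_mult_centralizer:
  assumes "w \<in> centralizer" "x \<in> carrier R"
  shows "(w \<otimes> x \<otimes> inv\<^bsub>W\<^esub> w) \<otimes> e = w \<otimes> (x \<otimes> e) \<otimes> inv\<^bsub>W\<^esub> w"
proof -
  have "w \<in> carrier W" using assms(1) by (simp add: centralizer_def)
  then show ?thesis using assms(2) centralizer_commutes_inv[OF assms(1)]
    by (simp add: R.m_assoc)
qed

text \<open>If the idempotent \<open>f = wew\<^sup>-\<^sup>1\<close> is \<open>xe\<close> with \<open>x\<close> a unit, then also \<open>e = x\<^sup>-\<^sup>1f\<close>, so the commuting
  idempotents \<open>e\<close> and \<open>f\<close> are equal.\<close>

lemma centralizer_if_conj_eq_translate:
  assumes w: "w \<in> carrier W" and x: "x \<in> carrier W" and eq: "w \<otimes> e \<otimes> inv\<^bsub>W\<^esub> w = x \<otimes> e"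
  shows "w \<in> centralizer"
proof -
  let ?f = "w \<otimes> e \<otimes> inv\<^bsub>W\<^esub> w"
  have "?f \<otimes> ?f = w \<otimes> (e \<otimes> e) \<otimes> inv\<^bsub>W\<^esub> w" using w by (simp add: R.m_assoc)
  then have "?f \<otimes> ?f = ?f" by (simp add: e_idem)
  moreover have "e = inv\<^bsub>W\<^esub> x \<otimes> ?f" using x unfolding eq by simp
  ultimately have f: "e = ?f"
    using w x eq e_comm_conj[OF w] e_idem
    by (intro R.commuting_idempotents_eq[of e ?f "inv\<^bsub>W\<^esub> x" x]) auto
  have "e \<otimes> w = ?f \<otimes> w" using f by simp
  also have "\<dots> = w \<otimes> e" using w by (simp add: R.m_assoc)
  finally show ?thesis using w by (simp add: centralizer_def)
qed

text \<open>If \<open>se = e\<close>, then \<open>ses\<^sup>-\<^sup>1 = es\<^sup>-\<^sup>1\<close> commutes with \<open>e\<close>. Since \<open>s\<^sup>-\<^sup>1e = e\<close>, this reads \<open>e = es\<^sup>-\<^sup>1\<close>, that is,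
  \<open>es = e\<close>. The one-sided description turns cosets of the stabilizer into the fibres of \<open>u \<mapsto> ue\<close>.\<close>

lemma stabilizer_eq: "stabilizer = {s \<in> carrier W. s \<otimes> e = e}"
proof (intro equalityI subsetI)
  fix s assume "s \<in> {s \<in> carrier W. s \<otimes> e = e}"
  then have s: "s \<in> carrier W" "s \<otimes> e = e" by auto
  have se: "inv\<^bsub>W\<^esub> s \<otimes> e = e" using s by (metis W_inv_cancel(4) e_closed)
  let ?t = "inv\<^bsub>W\<^esub> s"
  have t: "?t \<in> carrier W" using s by simp
  have "e \<otimes> ?t = (s \<otimes> e \<otimes> ?t)" using s by simp
  then have "e \<otimes> ?t \<otimes> e = e \<otimes> (e \<otimes> ?t)" using e_comm_conj[OF s(1)] by simp
  then have "e = e \<otimes> ?t" using t se by (simp add: R.m_assoc e_idem flip: R.m_assoc[of e e])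
  then have "e \<otimes> s = e \<otimes> ?t \<otimes> s" by simp
  then have "e \<otimes> s = e" using s by (simp add: R.m_assoc)
  then show "s \<in> stabilizer" using s by (simp add: stabilizer_def)
qed (auto simp: stabilizer_def)

lemma l_coset_stabilizer:
  assumes "x \<in> carrier W"
  shows "x <#\<^bsub>W\<^esub> stabilizer = {y \<in> carrier W. y \<otimes> e = x \<otimes> e}"
proof (intro equalityI subsetI)
  fix y assume "y \<in> {y \<in> carrier W. y \<otimes> e = x \<otimes> e}"
  then have "inv\<^bsub>W\<^esub> x \<otimes> y \<in> stabilizer" "y = x \<otimes> (inv\<^bsub>W\<^esub> x \<otimes> y)"
    using assms by (auto simp: stabilizer_eq R.m_assoc)
  then show "y \<in> x <#\<^bsub>W\<^esub> stabilizer" by (auto simp: l_coset_def W_mult)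
qed (use assms in \<open>auto simp: l_coset_def W_mult stabilizer_eq R.m_assoc\<close>)

lemma l_coset_stabilizer_eq_iff:
  assumes "x \<in> carrier W" "y \<in> carrier W"
  shows "x <#\<^bsub>W\<^esub> stabilizer = y <#\<^bsub>W\<^esub> stabilizer \<longleftrightarrow> x \<otimes> e = y \<otimes> e"
  using assms by (auto simp: l_coset_stabilizer)

text \<open>The action does not depend on the representative: for \<open>w\<close> in the centralizer,
  \<open>(wuw\<^sup>-\<^sup>1)e = w(ue)w\<^sup>-\<^sup>1\<close> is determined by \<open>ue\<close>, that is, by the coset of \<open>u\<close>.\<close>

lemma conj_coset_l_coset:
  assumes w: "w \<in> centralizer" and u: "u \<in> carrier W"
  shows "conj_coset w (u <#\<^bsub>W\<^esub> stabilizer) = (w \<otimes> u \<otimes> inv\<^bsub>W\<^esub> w) <#\<^bsub>W\<^esub> stabilizer"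
proof -
  have wW: "w \<in> carrier W" using w by (simp add: centralizer_def)
  have "(w \<otimes> b \<otimes> inv\<^bsub>W\<^esub> w) <#\<^bsub>W\<^esub> stabilizer = (w \<otimes> u \<otimes> inv\<^bsub>W\<^esub> w) <#\<^bsub>W\<^esub> stabilizer"
    if "b \<in> u <#\<^bsub>W\<^esub> stabilizer" for b
    using that w wW u
    by (subst l_coset_stabilizer_eq_iff) (auto simp: conj_mult_centralizer l_coset_stabilizer)
  moreover have "u \<in> u <#\<^bsub>W\<^esub> stabilizer" using u by (simp add: l_coset_stabilizer)
  ultimately show ?thesis unfolding conj_coset_def W_mult by blast
qed

lemma conjugate_sym:
  assumes "conjugate \<sigma> \<tau>" "\<sigma> \<in> carrier R"
  shows "conjugate \<tau> \<sigma>"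
proof -
  obtain w where w: "w \<in> carrier W" "\<tau> = w \<otimes> \<sigma> \<otimes> inv\<^bsub>W\<^esub> w"
    using assms(1) by (auto simp: conjugate_def)
  then have "\<sigma> = inv\<^bsub>W\<^esub> w \<otimes> \<tau> \<otimes> inv\<^bsub>W\<^esub> (inv\<^bsub>W\<^esub> w)"
    using assms(2) by (simp add: R.m_assoc)
  then show ?thesis using w(1) unfolding conjugate_def by (intro bexI[of _ "inv\<^bsub>W\<^esub> w"]) auto
qed

lemma conjugate_trans:
  assumes "conjugate \<rho> \<sigma>" "conjugate \<sigma> \<tau>" "\<rho> \<in> carrier R"
  shows "conjugate \<rho> \<tau>"
proof -
  obtain w x where w: "w \<in> carrier W" "\<sigma> = w \<otimes> \<rho> \<otimes> inv\<^bsub>W\<^esub> w"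
    and x: "x \<in> carrier W" "\<tau> = x \<otimes> \<sigma> \<otimes> inv\<^bsub>W\<^esub> x"
    using assms(1,2) by (auto simp: conjugate_def)
  have "inv\<^bsub>W\<^esub> (x \<otimes> w) = inv\<^bsub>W\<^esub> w \<otimes> inv\<^bsub>W\<^esub> x"
    using W.inv_mult_group[OF x(1) w(1)] by (simp add: W_mult)
  then have "\<tau> = (x \<otimes> w) \<otimes> \<rho> \<otimes> inv\<^bsub>W\<^esub> (x \<otimes> w)"
    using w x assms(3) by (simp add: R.m_assoc)
  then show ?thesis using w(1) x(1) unfolding conjugate_def by (intro bexI[of _ "x \<otimes> w"]) auto
qed

text \<open>With \<open>x = wuw\<^sup>-\<^sup>1\<close>, the equation \<open>ve = w(ue)w\<^sup>-\<^sup>1 = x(wew\<^sup>-\<^sup>1)\<close> exhibits \<open>wew\<^sup>-\<^sup>1\<close> as the translate \<open>(x\<^sup>-\<^sup>1v)e\<close>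
  of \<open>e\<close>, which puts \<open>w\<close> into the centralizer.\<close>

lemma conjugate_translates_iff:
  assumes u: "u \<in> carrier W" and v: "v \<in> carrier W"
  shows "conjugate (u \<otimes> e) (v \<otimes> e) \<longleftrightarrow>
    (\<exists>w\<in>centralizer. v \<otimes> e = (w \<otimes> u \<otimes> inv\<^bsub>W\<^esub> w) \<otimes> e)"
proof
  assume "conjugate (u \<otimes> e) (v \<otimes> e)"
  then obtain w where w: "w \<in> carrier W" and eq: "v \<otimes> e = w \<otimes> (u \<otimes> e) \<otimes> inv\<^bsub>W\<^esub> w"
    by (auto simp: conjugate_def)
  let ?x = "w \<otimes> u \<otimes> inv\<^bsub>W\<^esub> w"
  have x: "?x \<in> carrier W" using u w by simp
  have "inv\<^bsub>W\<^esub> ?x \<otimes> (v \<otimes> e) = w \<otimes> e \<otimes> inv\<^bsub>W\<^esub> w"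
    unfolding eq conj_mult[OF w W_in_R[OF u]] using x w by (intro W_inv_cancel(4)) auto
  then have "w \<otimes> e \<otimes> inv\<^bsub>W\<^esub> w = (inv\<^bsub>W\<^esub> ?x \<otimes> v) \<otimes> e"
    using x v by (simp add: R.m_assoc)
  then have "w \<in> centralizer"
    using x v w by (intro centralizer_if_conj_eq_translate) auto
  then show "\<exists>w\<in>centralizer. v \<otimes> e = (w \<otimes> u \<otimes> inv\<^bsub>W\<^esub> w) \<otimes> e"
    using eq u by (intro bexI[of _ w]) (auto simp: conj_mult_centralizer)
next
  assume "\<exists>w\<in>centralizer. v \<otimes> e = (w \<otimes> u \<otimes> inv\<^bsub>W\<^esub> w) \<otimes> e"
  then obtain w where "w \<in> centralizer" "v \<otimes> e = (w \<otimes> u \<otimes> inv\<^bsub>W\<^esub> w) \<otimes> e" by blast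
  then show "conjugate (u \<otimes> e) (v \<otimes> e)"
    using u unfolding conjugate_def
    by (intro bexI[of _ w]) (auto simp: conj_mult_centralizer centralizer_def)
qed

text \<open>The library's \<open>orbit\<close> of \<open>C\<close> is the set of all images of \<open>C\<close>, whether or not the map is a group
  action, so two cosets in the orbit of \<open>aW\<^sub>*(e)\<close> are compared through \<open>ae\<close>, using that
  conjugacy is an equivalence relation.\<close>

theorem conjugate_iff_same_orbit:
  assumes u: "u \<in> carrier W" and v: "v \<in> carrier W"
  shows "conjugate (u \<otimes> e) (v \<otimes> e) \<longleftrightarrow>
    (\<exists>X \<in> orbits (W\<lparr>carrier := centralizer\<rparr>) (lcosets\<^bsub>W\<^esub> stabilizer) conj_coset.
       u <#\<^bsub>W\<^esub> stabilizer \<in> X \<and> v <#\<^bsub>W\<^esub> stabilizer \<in> X)"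
    (is "?L \<longleftrightarrow> ?R")
proof
  assume ?L
  then obtain w where w: "w \<in> centralizer" "v \<otimes> e = (w \<otimes> u \<otimes> inv\<^bsub>W\<^esub> w) \<otimes> e"
    using conjugate_translates_iff[OF u v] by blast
  have one: "\<one> \<in> centralizer" by (simp add: centralizer_def)
  have "inv\<^bsub>W\<^esub> \<one> = \<one>" using W.inv_one by (simp add: W_one)
  then have C1: "conj_coset \<one> (u <#\<^bsub>W\<^esub> stabilizer) = u <#\<^bsub>W\<^esub> stabilizer"
    using conj_coset_l_coset[OF one u] u by simp
  have Cw: "conj_coset w (u <#\<^bsub>W\<^esub> stabilizer) = v <#\<^bsub>W\<^esub> stabilizer"
    using w u v unfolding conj_coset_l_coset[OF w(1) u]
    by (subst l_coset_stabilizer_eq_iff) (auto simp: centralizer_def)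
  let ?C = "u <#\<^bsub>W\<^esub> stabilizer" and ?O = "orbit (W\<lparr>carrier := centralizer\<rparr>) conj_coset"
  have "?C \<in> lcosets\<^bsub>W\<^esub> stabilizer"
    using u by (auto simp: LCOSETS_def)
  then have "?O ?C \<in> orbits (W\<lparr>carrier := centralizer\<rparr>) (lcosets\<^bsub>W\<^esub> stabilizer) conj_coset"
    unfolding orbits_def by blast
  moreover have "?C \<in> ?O ?C"
    unfolding orbit_def mem_Collect_eq by (rule exI[of _ \<one>]) (simp add: C1 one)
  moreover have "v <#\<^bsub>W\<^esub> stabilizer \<in> ?O ?C"
    unfolding orbit_def mem_Collect_eq by (rule exI[of _ w]) (simp add: Cw w(1))
  ultimately show ?R by blast
next
  assume ?R
  then obtain C where "C \<in> lcosets\<^bsub>W\<^esub> stabilizer"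
    and C: "u <#\<^bsub>W\<^esub> stabilizer \<in> orbit (W\<lparr>carrier := centralizer\<rparr>) conj_coset C"
      "v <#\<^bsub>W\<^esub> stabilizer \<in> orbit (W\<lparr>carrier := centralizer\<rparr>) conj_coset C"
    unfolding orbits_def by blast
  then obtain a where a: "a \<in> carrier W" and Ca: "C = a <#\<^bsub>W\<^esub> stabilizer"
    unfolding LCOSETS_def by blast
  obtain g where g: "g \<in> centralizer" "u <#\<^bsub>W\<^esub> stabilizer = conj_coset g (a <#\<^bsub>W\<^esub> stabilizer)"
    using C(1) unfolding orbit_def Ca by auto
  obtain h where h: "h \<in> centralizer" "v <#\<^bsub>W\<^esub> stabilizer = conj_coset h (a <#\<^bsub>W\<^esub> stabilizer)"
    using C(2) unfolding orbit_def Ca by auto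
  have "conjugate (a \<otimes> e) (b \<otimes> e)"
    if "b \<in> carrier W" "k \<in> centralizer" "b <#\<^bsub>W\<^esub> stabilizer = conj_coset k (a <#\<^bsub>W\<^esub> stabilizer)"
    for b k
  proof -
    have "k \<in> carrier W" using that(2) by (simp add: centralizer_def)
    then have "b \<otimes> e = (k \<otimes> a \<otimes> inv\<^bsub>W\<^esub> k) \<otimes> e"
      using that a by (simp add: conj_coset_l_coset l_coset_stabilizer_eq_iff)
    then show ?thesis using conjugate_translates_iff[OF a that(1)] that(2) by blast
  qed
  then have "conjugate (a \<otimes> e) (u \<otimes> e)" "conjugate (a \<otimes> e) (v \<otimes> e)"
    using u v g h by blast+
  then show ?L using a u by (meson R.m_closed W_in_R conjugate_sym conjugate_trans e_closed)
qed

end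

section \<open>Cosets of a subgroup of the units\<close>

text \<open>The subsets of \<open>Q\<close> invariant under multiplication by \<open>T\<close> from either side. This monoid contains the
  cosets \<open>xT = Tx\<close> and multiplies them as \<open>(xT)(yT) = xyT\<close>, so that products of such cosets in the
  Renner monoid can be computed in it; associativity is immediate for sets.\<close>

definition biinvariant_monoid :: "('a, 'b) monoid_scheme \<Rightarrow> 'a set \<Rightarrow> 'a set monoid" where
  "biinvariant_monoid Q T =
     \<lparr>carrier = {X. X \<subseteq> carrier Q \<and> T <#>\<^bsub>Q\<^esub> X = X \<and> X <#>\<^bsub>Q\<^esub> T = X}, mult = set_mult Q, one = T\<rparr>"

context monoid
begin

lemma set_mult_assoc_subset:
  assumes "X \<subseteq> carrier G" "Y \<subseteq> carrier G" "Z \<subseteq> carrier G"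
  shows "(X <#> Y) <#> Z = X <#> (Y <#> Z)"
proof (intro equalityI subsetI)
  fix a assume "a \<in> (X <#> Y) <#> Z"
  then obtain x y z where xyz: "x \<in> X" "y \<in> Y" "z \<in> Z" "a = (x \<otimes> y) \<otimes> z"
    unfolding set_mult_def by auto
  then have "a = x \<otimes> (y \<otimes> z)" using assms by (metis m_assoc subsetD)
  then show "a \<in> X <#> (Y <#> Z)" using xyz unfolding set_mult_def by blast
next
  fix a assume "a \<in> X <#> (Y <#> Z)"
  then obtain x y z where xyz: "x \<in> X" "y \<in> Y" "z \<in> Z" "a = x \<otimes> (y \<otimes> z)"
    unfolding set_mult_def by auto
  then have "a = (x \<otimes> y) \<otimes> z" using assms by (metis m_assoc subsetD)
  then show "a \<in> (X <#> Y) <#> Z" using xyz unfolding set_mult_def by blast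
qed

lemma biinvariant_monoid_is_monoid:
  assumes T: "T \<subseteq> carrier G" "T <#> T = T"
  shows "monoid (biinvariant_monoid G T)"
proof (rule monoidI)
  fix X Y assume "X \<in> carrier (biinvariant_monoid G T)" "Y \<in> carrier (biinvariant_monoid G T)"
  then have "X \<subseteq> carrier G" "T <#> X = X" "Y \<subseteq> carrier G" "Y <#> T = Y"
    by (auto simp: biinvariant_monoid_def)
  then show "X \<otimes>\<^bsub>biinvariant_monoid G T\<^esub> Y \<in> carrier (biinvariant_monoid G T)"
    using T set_mult_closed[of X Y] set_mult_assoc_subset[of T X Y] set_mult_assoc_subset[of X Y T]
    by (simp add: biinvariant_monoid_def)
qed (use T in \<open>auto simp: biinvariant_monoid_def set_mult_assoc_subset\<close>)

lemma l_coset_set_mult_l_coset: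
  assumes T: "T \<subseteq> carrier G" "T <#> T = T" and "a \<in> carrier G" "b \<in> carrier G"
    and "T #> b = b <# T"
  shows "(a <# T) <#> (b <# T) = (a \<otimes> b) <# T"
proof -
  have "(a <# T) <#> (b <# T) = {a} <#> ((T <#> {b}) <#> T)"
    using assms by (simp add: l_coset_eq_set_mult set_mult_assoc_subset set_mult_closed)
  also have "\<dots> = {a} <#> (({b} <#> T) <#> T)"
    using assms(5) by (simp add: l_coset_eq_set_mult r_coset_eq_set_mult)
  also have "\<dots> = ({a} <#> {b}) <#> T"
    using assms by (simp add: set_mult_assoc_subset)
  also have "{a} <#> {b} = {a \<otimes> b}" by (auto simp: set_mult_def)
  finally show ?thesis by (simp add: l_coset_eq_set_mult)
qed

lemma l_coset_in_biinvariant_monoid: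
  assumes "T \<subseteq> carrier G" "T <#> T = T" "a \<in> carrier G" "T #> a = a <# T"
  shows "a <# T \<in> carrier (biinvariant_monoid G T)"
proof -
  have "a <# T \<subseteq> carrier G" using assms by (auto simp: l_coset_def)
  moreover have "(a <# T) <#> T = a <# T"
    using assms by (simp add: l_coset_eq_set_mult set_mult_assoc_subset)
  moreover have "T <#> (a <# T) = a <# T"
  proof -
    have "T <#> (T #> a) = (T <#> T) <#> {a}"
      using assms(1,3) by (simp add: r_coset_eq_set_mult set_mult_assoc_subset)
    also have "\<dots> = T #> a" by (simp add: assms(2) r_coset_eq_set_mult)
    finally show ?thesis by (simp only: assms(4))
  qed
  ultimately show ?thesis by (simp add: biinvariant_monoid_def)
qed

text \<open>Both \<open>e\<close> and the elements \<open>x\<close> of the normalizer satisfy \<open>xT = Tx\<close>, so \<open>x \<mapsto> xT\<close> is multiplicative on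
  products formed from them, and the commutation of \<open>e\<close> with \<open>xex\<^sup>-\<^sup>1\<close> passes to cosets.\<close>

lemma idempotent_over_weyl_group:
  assumes T: "subgroup T (units_of G)"
    and e: "e \<in> carrier G" "e \<otimes> e = e"
    and eT: "\<And>t. t \<in> T \<Longrightarrow> t \<otimes> e = e \<otimes> t"
    and conj: "\<And>x. x \<in> normalizer (units_of G) T \<Longrightarrow>
      (x \<otimes> e \<otimes> inv x) \<otimes> e = e \<otimes> (x \<otimes> e \<otimes> inv x)"
  shows "idempotent_over_unit_group (biinvariant_monoid G T)
    ((units_of G)\<lparr>carrier := normalizer (units_of G) T\<rparr> Mod T) (e <# T)"
proof -
  let ?U = "units_of G"
  let ?N = "?U\<lparr>carrier := normalizer ?U T\<rparr>"
  let ?R = "biinvariant_monoid G T"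
  interpret U: group ?U by (rule units_group)
  interpret NT: normal T ?N by (rule U.subgroup_in_normalizer[OF T])
  have N: "normalizer ?U T \<subseteq> Units G"
    using subgroup.subset[OF U.normalizer_imp_subgroup[OF subgroup.subset[OF T]]]
    by (simp add: units_of_carrier)
  have TG: "T \<subseteq> carrier G"
    using subgroup.subset[OF T] by (auto simp: units_of_carrier)
  have TT: "T <#> T = T"
    using U.subgroup_mult_id[OF T] by (simp add: set_mult_def units_of_mult)
  have cosN: "T #>\<^bsub>?N\<^esub> x = x <# T" "T #> x = x <# T" "x \<in> carrier G"
    if "x \<in> normalizer ?U T" for x
    using that NT.coset_eq N by (auto simp: r_coset_def l_coset_def units_of_mult)
  have coscomm: "T #> e = e <# T" using eT by (auto simp: r_coset_def l_coset_def)
  have W: "carrier (?N Mod T) = (\<lambda>x. x <# T) ` normalizer ?U T"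
    using cosN(1) by (auto simp: FactGroup_def RCOSETS_def)
  interpret R: monoid ?R by (rule biinvariant_monoid_is_monoid[OF TG TT])
  interpret W: group "?N Mod T" by (rule NT.factorgroup_is_group)
  have mR: "mult ?R = set_mult G" by (simp add: biinvariant_monoid_def)
  note mult = l_coset_set_mult_l_coset[OF TG TT]
  show ?thesis
  proof
    show "carrier (?N Mod T) \<subseteq> carrier ?R"
      using cosN l_coset_in_biinvariant_monoid[OF TG TT] by (auto simp: W)
    show "mult (?N Mod T) = mult ?R"
      by (intro ext) (simp add: mR FactGroup_def set_mult_def units_of_mult)
    show "one (?N Mod T) = one ?R" by (simp add: biinvariant_monoid_def FactGroup_def)
    show "e <# T \<in> carrier ?R" by (rule l_coset_in_biinvariant_monoid[OF TG TT e(1) coscomm])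
    show "(e <# T) \<otimes>\<^bsub>?R\<^esub> (e <# T) = e <# T"
      using mult[OF e(1) e(1) coscomm] e by (simp add: mR)
    fix w assume "w \<in> carrier (?N Mod T)"
    then obtain x where x: "x \<in> normalizer ?U T" "w = x <# T" by (auto simp: W)
    have xU: "x \<in> Units G" using x N by blast
    have "inv\<^bsub>?N\<^esub> x = inv x"
      using U.m_inv_consistent[OF U.normalizer_imp_subgroup[OF subgroup.subset[OF T]] x(1)]
        units_of_inv[OF xU] by simp
    moreover have "inv\<^bsub>?N\<^esub> x \<in> normalizer ?U T" using x NT.inv_closed[of x] by simp
    ultimately have y: "inv x \<in> normalizer ?U T" "inv\<^bsub>?N Mod T\<^esub> w = inv x <# T"
      using x cosN(1) NT.rcos_inv[of x] NT.inv_FactGroup[of w] \<open>w \<in> carrier (?N Mod T)\<close> by auto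
    have R: "w \<in> carrier ?R" "e <# T \<in> carrier ?R" "inv\<^bsub>?N Mod T\<^esub> w \<in> carrier ?R"
      using x y cosN e coscomm l_coset_in_biinvariant_monoid[OF TG TT] by auto
    have "w \<otimes>\<^bsub>?R\<^esub> (e <# T) \<otimes>\<^bsub>?R\<^esub> inv\<^bsub>?N Mod T\<^esub> w \<otimes>\<^bsub>?R\<^esub> (e <# T)
        = ((x \<otimes> e \<otimes> inv x) \<otimes> e) <# T"
      using x y cosN[OF x(1)] cosN[OF y(1)] e coscomm by (simp add: mR mult)
    also have "\<dots> = (e \<otimes> x \<otimes> e \<otimes> inv x) <# T"
      using conj[OF x(1)] cosN(3)[OF x(1)] cosN(3)[OF y(1)] e by (simp add: m_assoc)
    also have "\<dots> = (e <# T) \<otimes>\<^bsub>?R\<^esub> w \<otimes>\<^bsub>?R\<^esub> (e <# T) \<otimes>\<^bsub>?R\<^esub> inv\<^bsub>?N Mod T\<^esub> w"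
      using x y cosN[OF x(1)] cosN[OF y(1)] e coscomm by (simp add: mR mult)
    finally show "w \<otimes>\<^bsub>?R\<^esub> (e <# T) \<otimes>\<^bsub>?R\<^esub> inv\<^bsub>?N Mod T\<^esub> w \<otimes>\<^bsub>?R\<^esub> (e <# T)
       = (e <# T) \<otimes>\<^bsub>?R\<^esub> (w \<otimes>\<^bsub>?R\<^esub> (e <# T) \<otimes>\<^bsub>?R\<^esub> inv\<^bsub>?N Mod T\<^esub> w)"
      using R by (simp add: R.m_assoc)
  qed
qed

end

section \<open>Commutation in the Zariski closure of a torus\<close>

lemma poly_fun_sum:
  assumes "finite I" "\<And>i. i \<in> I \<Longrightarrow> f i \<in> poly_fun n"
  shows "(\<lambda>A. \<Sum>i\<in>I. f i A) \<in> poly_fun n"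
  using assms by (induction I rule: finite_induct) (auto intro: poly_fun.intros)

lemma poly_fun_two_sided_mult_entry:
  fixes P Q :: "'k::field mat"
  assumes P: "P \<in> carrier_mat n n" and Q: "Q \<in> carrier_mat n n" and ij: "i < n" "j < n"
  shows "\<exists>f\<in>poly_fun n. \<forall>A\<in>carrier_mat n n. (P * A * Q) $$ (i, j) = f A"
proof
  let ?f = "\<lambda>A. \<Sum>l\<in>{0..<n}. P $$ (i, l) * (\<Sum>k\<in>{0..<n}. A $$ (l, k) * Q $$ (k, j))"
  show "?f \<in> poly_fun n"
    by (intro poly_fun_sum poly_fun.intros) auto
  show "\<forall>A\<in>carrier_mat n n. (P * A * Q) $$ (i, j) = ?f A"
    using P Q ij by (auto simp: scalar_prod_def)
qed

lemma openin_zariski: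
  "openin (zariski n) U \<longleftrightarrow> U \<subseteq> carrier_mat n n \<and>
     (\<exists>F \<subseteq> poly_fun n. carrier_mat n n - U = zero_locus n F)"
  unfolding zariski_def topology_inverse'[OF istopology_zariski] ..

lemma topspace_zariski: "topspace (zariski n) = (carrier_mat n n :: 'k::field mat set)"
proof (rule antisym)
  show "topspace (zariski n) \<subseteq> (carrier_mat n n :: 'k mat set)"
    using openin_zariski[of n "topspace (zariski n :: 'k mat topology)"] by simp
  have "openin (zariski n) (carrier_mat n n :: 'k mat set)"
    unfolding openin_zariski
    by (auto intro!: exI[of _ "{\<lambda>A. 1}"] simp: zero_locus_def poly_fun.const)
  then show "(carrier_mat n n :: 'k mat set) \<subseteq> topspace (zariski n)"
    by (rule openin_subset)
qed

lemma closedin_zariski_zero_locus: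
  assumes "F \<subseteq> poly_fun n"
  shows "closedin (zariski n) (zero_locus n F)"
proof -
  have "carrier_mat n n - (carrier_mat n n - zero_locus n F) = zero_locus n F"
    by (auto simp: zero_locus_def)
  then show ?thesis
    unfolding closedin_def topspace_zariski openin_zariski using assms by (auto simp: zero_locus_def)
qed

text \<open>The entries of \<open>PAQ\<close> are linear in those of \<open>A\<close>. The coefficients on both sides make one
  lemma cover equations such as \<open>AC = CA\<close> and \<open>(XAY)B = B(XAY)\<close>.\<close>

lemma closedin_zariski_linear_equation:
  fixes P Q P' Q' :: "'k::field mat"
  assumes "P \<in> carrier_mat n n" "Q \<in> carrier_mat n n" "P' \<in> carrier_mat n n" "Q' \<in> carrier_mat n n"
  shows "closedin (zariski n) {A \<in> carrier_mat n n. P * A * Q = P' * A * Q'}"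
proof -
  define f where "f R S i j = (SOME p. p \<in> poly_fun n \<and>
     (\<forall>A\<in>carrier_mat n n. (R * A * S) $$ (i, j) = p A))" for R S :: "'k mat" and i j
  have f: "f R S i j \<in> poly_fun n"
    "\<And>A. A \<in> carrier_mat n n \<Longrightarrow> (R * A * S) $$ (i, j) = f R S i j A"
    if "R \<in> carrier_mat n n" "S \<in> carrier_mat n n" "i < n" "j < n" for R S i j
    using someI_ex[OF poly_fun_two_sided_mult_entry[OF that, unfolded Bex_def]]
    unfolding f_def by blast+
  let ?F = "{\<lambda>A. f P Q i j A + (-1) * f P' Q' i j A | i j. i < n \<and> j < n}"
  have "{A \<in> carrier_mat n n. P * A * Q = P' * A * Q'} = zero_locus n ?F"
  proof (intro equalityI subsetI)
    fix A assume "A \<in> {A \<in> carrier_mat n n. P * A * Q = P' * A * Q'}"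
    then have A: "A \<in> carrier_mat n n" "P * A * Q = P' * A * Q'" by auto
    have "f P Q i j A = f P' Q' i j A" if "i < n" "j < n" for i j
      using f(2)[OF assms(1,2) that A(1)] f(2)[OF assms(3,4) that A(1)] A(2) by simp
    then show "A \<in> zero_locus n ?F" using A(1) by (auto simp: zero_locus_def)
  next
    fix A assume "A \<in> zero_locus n ?F"
    then have A: "A \<in> carrier_mat n n" and 0: "\<And>h. h \<in> ?F \<Longrightarrow> h A = 0"
      by (auto simp: zero_locus_def)
    have fg: "f P Q i j A = f P' Q' i j A" if "i < n" "j < n" for i j
      using 0[of "\<lambda>A. f P Q i j A + (-1) * f P' Q' i j A"] that by fastforce
    have "P * A * Q = P' * A * Q'"
    proof (rule eq_matI)
      fix i j assume "i < dim_row (P' * A * Q')" "j < dim_col (P' * A * Q')"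
      then have "i < n" "j < n" using assms by auto
      then show "(P * A * Q) $$ (i, j) = (P' * A * Q') $$ (i, j)"
        using f(2)[OF assms(1,2) _ _ A] f(2)[OF assms(3,4) _ _ A] fg by simp
    qed (use assms in auto)
    then show "A \<in> {A \<in> carrier_mat n n. P * A * Q = P' * A * Q'}" using A by simp
  qed
  moreover have "?F \<subseteq> poly_fun n" using f(1)[OF assms(1,2)] f(1)[OF assms(3,4)]
    by clarify (intro poly_fun.intros; blast)
  ultimately show ?thesis by (simp only: closedin_zariski_zero_locus)
qed

lemma zclosure_linear_equation:
  fixes P Q P' Q' :: "'k::field mat"
  assumes "P \<in> carrier_mat n n" "Q \<in> carrier_mat n n" "P' \<in> carrier_mat n n" "Q' \<in> carrier_mat n n"
    and "S \<subseteq> carrier_mat n n" "\<And>A. A \<in> S \<Longrightarrow> P * A * Q = P' * A * Q'" "A \<in> zclosure n M S"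
  shows "P * A * Q = P' * A * Q'"
proof -
  have "A \<in> zariski n closure_of S"
    using assms(7) closure_of_subtopology_subset unfolding zclosure_def by fast
  moreover have "zariski n closure_of S \<subseteq> {A \<in> carrier_mat n n. P * A * Q = P' * A * Q'}"
    using assms by (intro closure_of_minimal closedin_zariski_linear_equation) auto
  ultimately show ?thesis by blast
qed

lemma zclosure_subset:
  assumes "S \<subseteq> carrier_mat n n" "M \<subseteq> carrier_mat n n"
  shows "zclosure n M S \<subseteq> M"
  unfolding zclosure_def
  using closure_of_subset_topspace[of "subtopology (zariski n) M" S] by auto

text \<open>Closedness is applied twice: the elements of the closure commute with \<open>S\<close>, and therefore with
  everything that commutes with \<open>S\<close>, in particular with one another.\<close>

lemma zclosure_commute:
  fixes S :: "'k::field mat set"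
  assumes S: "S \<subseteq> carrier_mat n n" and M: "M \<subseteq> carrier_mat n n"
    and comm: "\<And>A B. A \<in> S \<Longrightarrow> B \<in> S \<Longrightarrow> A * B = B * A"
    and A: "A \<in> zclosure n M S" and B: "B \<in> zclosure n M S"
  shows "A * B = B * A"
proof -
  have *: "A * C = C * A" if C: "C \<in> carrier_mat n n" and A: "A \<in> zclosure n M S"
    and SC: "\<And>D. D \<in> S \<Longrightarrow> D * C = C * D" for A C
  proof -
    have "A \<in> carrier_mat n n" using A M zclosure_subset[OF S M] by blast
    moreover have "1\<^sub>m n * A * C = C * A * 1\<^sub>m n"
    proof (rule zclosure_linear_equation[OF _ _ _ _ S _ A])
      fix D assume "D \<in> S"
      then have "D \<in> carrier_mat n n" "D * C = C * D" using S SC by auto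
      then show "1\<^sub>m n * D * C = C * D * 1\<^sub>m n" using C by simp
    qed (use C in auto)
    ultimately show ?thesis using C by auto
  qed
  show ?thesis
  proof (rule *[OF _ A])
    show "B \<in> carrier_mat n n" using B M zclosure_subset[OF S M] by blast
    fix D assume D: "D \<in> S"
    then have "D \<in> carrier_mat n n" using S by blast
    then show "D * B = B * D" using *[OF _ B] comm[OF _ D] by metis
  qed
qed

text \<open>For \<open>A \<in> S\<close> both \<open>XAY\<close> and \<open>B\<close> lie in the commutative closure of \<open>S\<close>. The equation is linear in
  \<open>A\<close>, so it extends to \<open>A\<close> in the closure. This avoids showing that \<open>A \<mapsto> XAY\<close> is continuous.\<close>

lemma zclosure_conj_commute:
  fixes S :: "'k::field mat set"
  assumes S: "S \<subseteq> carrier_mat n n" and M: "M \<subseteq> carrier_mat n n"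
    and comm: "\<And>A B. A \<in> S \<Longrightarrow> B \<in> S \<Longrightarrow> A * B = B * A"
    and X: "X \<in> carrier_mat n n" "Y \<in> carrier_mat n n"
    and conj: "\<And>A. A \<in> S \<Longrightarrow> X * A * Y \<in> zclosure n M S"
    and A: "A \<in> zclosure n M S" and B: "B \<in> zclosure n M S"
  shows "(X * A * Y) * B = B * (X * A * Y)"
proof -
  have carr: "A \<in> carrier_mat n n" "B \<in> carrier_mat n n"
    using A B M zclosure_subset[OF S M] by blast+
  have "X * A * (Y * B) = (B * X) * A * Y"
  proof (rule zclosure_linear_equation[OF _ _ _ _ S _ A])
    fix D assume D: "D \<in> S"
    have "(X * D * Y) * B = B * (X * D * Y)"
      by (rule zclosure_commute[OF S M comm conj[OF D] B])
    then show "X * D * (Y * B) = (B * X) * D * Y"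
      using S D X carr by (auto simp: assoc_mult_mat[of _ n n _ n _ n])
  qed (use X carr in auto)
  then show ?thesis using X carr by (simp add: assoc_mult_mat[of _ n n _ n _ n])
qed

lemma diagonal_mat_commute:
  fixes A B :: "'a::comm_semiring_0 mat"
  assumes A: "A \<in> carrier_mat r r" "diagonal_mat A" and B: "B \<in> carrier_mat r r" "diagonal_mat B"
  shows "A * B = B * A"
proof (rule eq_matI)
  fix i j assume "i < dim_row (B * A)" "j < dim_col (B * A)"
  then have ij: "i < r" "j < r" using A B by auto
  have entry: "(C * D) $$ (i, j) = (if i = j then C $$ (i, i) * D $$ (i, i) else 0)"
    if "C \<in> carrier_mat r r" "diagonal_mat C" "D \<in> carrier_mat r r" "diagonal_mat D"
    for C D :: "'a mat"
  proof -
    have "(C * D) $$ (i, j) = (\<Sum>k\<in>{0..<r}. C $$ (i, k) * D $$ (k, j))"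
      using that ij by (auto simp: scalar_prod_def)
    also have "\<dots> = (\<Sum>k\<in>{0..<r}. if k = i then C $$ (i, i) * D $$ (i, j) else 0)"
      using that ij by (intro sum.cong) (auto simp: diagonal_mat_def)
    also have "\<dots> = C $$ (i, i) * D $$ (i, j)" using ij by simp
    finally show ?thesis using that ij by (auto simp: diagonal_mat_def)
  qed
  show "(A * B) $$ (i, j) = (B * A) $$ (i, j)"
    using entry[OF A B] entry[OF B A] by (simp add: mult.commute)
qed (use A B in auto)

lemma torus_commute:
  fixes T :: "'k::field mat set"
  assumes "torus n G T" "A \<in> T" "B \<in> T"
  shows "A \<otimes>\<^bsub>G\<^esub> B = B \<otimes>\<^bsub>G\<^esub> A"
proof -
  obtain r and \<phi> :: "'k mat \<Rightarrow> 'k mat" where \<phi>: "\<phi> \<in> iso (diag_group r) (G\<lparr>carrier := T\<rparr>)"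
    using assms(1) unfolding torus_def by blast
  then have "T = \<phi> ` carrier (diag_group r)" by (auto simp: iso_def bij_betw_def)
  then obtain a b where ab: "a \<in> carrier (diag_group r)" "b \<in> carrier (diag_group r)"
    "A = \<phi> a" "B = \<phi> b" using assms(2,3) by auto
  then have "a * b = b * a"
    by (intro diagonal_mat_commute[of a r b]) (auto simp: diag_group_def mat_monoid_def)
  then have "a \<otimes>\<^bsub>diag_group r\<^esub> b = b \<otimes>\<^bsub>diag_group r\<^esub> a"
    by (simp add: diag_group_def mat_monoid_def)
  moreover have "\<phi> (x \<otimes>\<^bsub>diag_group r\<^esub> y) = \<phi> x \<otimes>\<^bsub>G\<^esub> \<phi> y"
    if "x \<in> carrier (diag_group r)" "y \<in> carrier (diag_group r)" for x y
    using \<phi> that hom_mult[of \<phi> "diag_group r" "G\<lparr>carrier := T\<rparr>" x y] by (simp add: iso_def)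
  ultimately show ?thesis using ab by metis
qed

section \<open>Conjugacy in the Renner monoid\<close>

lemma monoid_mat_monoid:
  assumes "linear_algebraic_monoid n M"
  shows "monoid (mat_monoid n M)" "M \<subseteq> carrier_mat n n"
proof -
  let ?C = "mat_monoid n (carrier_mat n n) :: 'a mat monoid"
  have "monoid ?C"
    by (rule monoidI) (auto simp: mat_monoid_def assoc_mult_mat[of _ n n _ n _ n])
  moreover have sub: "submonoid M ?C" using assms by (simp add: linear_algebraic_monoid_def)
  ultimately have "monoid (?C\<lparr>carrier := M\<rparr>)" by (intro submonoid.submonoid_is_monoid)
  then show "monoid (mat_monoid n M)" by (simp add: mat_monoid_def)
  show "M \<subseteq> carrier_mat n n" using submonoid.subset[OF sub] by (simp add: mat_monoid_def)
qed

theorem theorem3p4: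
  fixes n :: nat and M T B :: "'k::alg_closed_field mat set"
    and e :: "'k mat" and u v :: "'k mat set"
  assumes "reductive_monoid n M"
    and "maximal_torus n (unit_group n M) T"
    and "borel_subgroup n (unit_group n M) B"
    and "T \<subseteq> B"
    and "e \<in> cross_section_lattice n M T B"
    and "u \<in> carrier (weyl_group n M T)"
    and "v \<in> carrier (weyl_group n M T)"
  shows "renner_conj n M T
           (u \<otimes>\<^bsub>renner_monoid n M T\<^esub> renner_idem n M T e)
           (v \<otimes>\<^bsub>renner_monoid n M T\<^esub> renner_idem n M T e)
         \<longleftrightarrow>
         same_coset_orbit n M T e
           (u <#\<^bsub>weyl_group n M T\<^esub> W_stabilizer n M T e)
           (v <#\<^bsub>weyl_group n M T\<^esub> W_stabilizer n M T e)"
proof -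
  let ?Q = "mat_monoid n M" and ?U = "unit_group n M"
  let ?R = "biinvariant_monoid ?Q T" and ?W = "weyl_group n M T" and ?E = "e <#\<^bsub>mat_monoid n M\<^esub> T"
  have M: "linear_algebraic_monoid n M" using assms(1) by (simp add: reductive_monoid_def)
  interpret Q: monoid ?Q by (rule monoid_mat_monoid[OF M])
  interpret U: group ?U unfolding unit_group_def by (rule Q.units_group)
  have Msub: "M \<subseteq> carrier_mat n n" by (rule monoid_mat_monoid[OF M])
  have torus: "torus n ?U T" using assms(2) by (simp add: maximal_torus_def)
  then have T: "subgroup T ?U" by (simp add: torus_def closed_subgroup_def)
  have "carrier ?Q = M" by (simp add: mat_monoid_def)
  moreover have "Units ?Q \<subseteq> carrier ?Q" by (auto dest: Q.Units_closed)
  ultimately have units: "carrier ?U = Units ?Q" "Units ?Q \<subseteq> M"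
    by (simp_all add: unit_group_def units_of_carrier)
  then have TM: "T \<subseteq> M" "T \<subseteq> carrier_mat n n" using subgroup.subset[OF T] Msub by auto
  have mult: "mult ?Q = (*)" "mult ?U = (*)"
    by (simp_all add: mat_monoid_def unit_group_def units_of_mult)
  have Tcomm: "a * b = b * a" if "a \<in> T" "b \<in> T" for a b
    using torus_commute[OF torus that] by (simp add: mult)
  have e: "e \<in> zclosure n M T" "e * e = e"
    using assms(5) by (auto simp: cross_section_lattice_def torus_idempotents_def)
  have eM: "e \<in> M" using e zclosure_subset[OF TM(2) Msub] by blast
  have Tcl: "T \<subseteq> zclosure n M T"
    using TM unfolding zclosure_def
    by (intro closure_of_subset) (simp add: topspace_zariski)
  have "idempotent_over_unit_group ?R ?W ?E"
    unfolding weyl_group_def torus_normalizer_def unit_group_def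
  proof (rule Q.idempotent_over_weyl_group)
    show "subgroup T (units_of ?Q)" using T by (simp add: unit_group_def)
    show "e \<in> carrier ?Q" "e \<otimes>\<^bsub>?Q\<^esub> e = e" using eM e by (simp_all add: mat_monoid_def)
    show "t \<otimes>\<^bsub>?Q\<^esub> e = e \<otimes>\<^bsub>?Q\<^esub> t" if "t \<in> T" for t
      using zclosure_commute[OF TM(2) Msub Tcomm _ e(1), of t] that Tcl by (auto simp: mult)
    fix x assume "x \<in> normalizer (units_of ?Q) T"
    then have x: "x \<in> carrier ?U" "x <#\<^bsub>?U\<^esub> T #>\<^bsub>?U\<^esub> inv\<^bsub>?U\<^esub> x = T"
      using subgroup.subset[OF T] by (auto simp: normalizer_def stabilizer_def unit_group_def)
    have xU: "x \<in> Units ?Q" using x units by simp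
    have inv: "inv\<^bsub>?U\<^esub> x = inv\<^bsub>?Q\<^esub> x"
      unfolding unit_group_def by (rule Q.units_of_inv[OF xU])
    have "x * t * inv\<^bsub>?Q\<^esub> x \<in> T" if "t \<in> T" for t
      using that by (subst x(2)[symmetric]) (auto simp: l_coset_def r_coset_def mult inv)
    then have "(x * e * inv\<^bsub>?Q\<^esub> x) * e = e * (x * e * inv\<^bsub>?Q\<^esub> x)"
      using xU Q.Units_inv_Units[OF xU] units(2) Msub Tcl
      by (intro zclosure_conj_commute[OF TM(2) Msub Tcomm _ _ _ e(1) e(1)]) auto
    then show "x \<otimes>\<^bsub>?Q\<^esub> e \<otimes>\<^bsub>?Q\<^esub> inv\<^bsub>?Q\<^esub> x \<otimes>\<^bsub>?Q\<^esub> e = e \<otimes>\<^bsub>?Q\<^esub> (x \<otimes>\<^bsub>?Q\<^esub> e \<otimes>\<^bsub>?Q\<^esub> inv\<^bsub>?Q\<^esub> x)"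
      by (simp add: mult)
  qed
  then interpret I: idempotent_over_unit_group ?R ?W ?E .
  have R: "mult (renner_monoid n M T) = mult ?R"
    by (simp add: renner_monoid_def biinvariant_monoid_def)
  have "W_stabilizer n M T e = I.stabilizer" "W_centralizer n M T e = I.centralizer"
    by (simp_all add: W_stabilizer_def W_centralizer_def I.stabilizer_def I.centralizer_def
        renner_idem_def R)
  moreover from this have "coset_action n M T e = I.conj_coset"
    by (intro ext) (simp add: coset_action_def I.conj_coset_def)
  ultimately show ?thesis
    using I.conjugate_iff_same_orbit[OF assms(6,7)]
    unfolding renner_conj_def I.conjugate_def same_coset_orbit_def W_cosets_def renner_idem_def R
    by simp
qed

end
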